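(* Let $\mathscr{M}$ be a von Neumann algebra acting on the Hilbert space $\mathcal{H}$, and let $T\in\mathscr{M}_{\mathrm{aff}}$. Let $A/B$ be a quotient representation of $T$ with $A,B\in\mathscr{M}$ satisfying $\mathrm{null}(B)\subseteq\mathrm{null}(A)$. Then: (i) $\mathbf{R}(T)$ and $\mathbf{N}(T)$ are both contained in $\mathscr{M}$. In fact, $\mathbf{N}(T)=\mathbf{R}\big(B\,\mathbf{N}(A)\big)$. (ii) $T^{\dagger}$ is contained in $\mathscr{M}_{\mathrm{aff}}$ with quotient representation $T^{\dagger} = \big((I-\mathbf{N}(T))\,B\big)/A$. (iii) $T$ is one-to-one if and only if $\mathrm{null}(A)=\mathrm{null}(B)$, in which case $T^{-1}$ lies in $\mathscr{M}_{\mathrm{aff}}$ with quotient representation $B/A$.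
   Context: An unbounded operator on $\mathcal{H}$ is a linear map $T:\mathrm{dom}(T)\to\mathcal{H}$ with $\mathrm{dom}(T)$ a (not necessarily dense) linear subspace of $\mathcal{H}$, and $T$ not necessarily bounded; equality of operators includes equality of domains. $\mathrm{null}(T)=\{x\in\mathrm{dom}(T):Tx=0\}$, $\mathrm{ran}(T)=\{Tx:x\in\mathrm{dom}(T)\}$. $\mathbf{R}(T)$ is the orthogonal projection of $\mathcal{H}$ onto $\overline{\mathrm{ran}(T)}$, and $\mathbf{N}(T)$ is the orthogonal projection of $\mathcal{H}$ onto $\overline{\mathrm{null}(T)}$. For $A,B\in\mathcal{B}(\mathcal{H})$ with $\mathrm{null}(B)\subseteq\mathrm{null}(A)$, the quotient $A/B$ is the unbounded operator with domain $\mathrm{ran}(B)$ given by $Bx\mapsto Ax$ ($x\in\mathcal{H}$). $\mathscr{M}_{\mathrm{aff}} := \{A/B : A,B\in\mathscr{M},\ \mathrm{null}(B)\subseteq\mathrm{null}(A)\}$. The Kaufman inverse $T^{\dagger}$ of an unbounded operator $T$ is the unbounded operator with $\mathrm{dom}(T^{\dagger})=\mathrm{ran}(T)$ given by $Tx\mapsto (I-\mathbf{N}(T))x$ ($x\in\mathrm{dom}(T)$). When $T$ is one-to-one, $T^{\dagger}=T^{-1}$ with domain $\mathrm{ran}(T)$. *)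

theory Defs
  imports "HOL-Analysis.Analysis"
begin

section \<open>Complex Hilbert spaces\<close>

text \<open>A complex inner product space is presented on top of its underlying real inner product
  space, \<open>x \<bullet> y = Re \<langle>x, y\<rangle>\<close>. Hence \<open>\<langle>x, x\<rangle> = \<parallel>x\<parallel>\<^sup>2\<close>, so positive definiteness
  and the norm topology are those of the class \<open>real_inner\<close>.
  The form is linear in its first argument.\<close>

class complex_inner = real_inner +
  fixes scaleC :: "complex \<Rightarrow> 'a \<Rightarrow> 'a"  (infixr "*\<^sub>C" 75)
    and cinner :: "'a \<Rightarrow> 'a \<Rightarrow> complex"
  assumes scaleR_scaleC: "r *\<^sub>R x = complex_of_real r *\<^sub>C x"
    and scaleC_add_right: "c *\<^sub>C (x + y) = c *\<^sub>C x + c *\<^sub>C y"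
    and scaleC_add_left: "(c + d) *\<^sub>C x = c *\<^sub>C x + d *\<^sub>C x"
    and scaleC_scaleC: "c *\<^sub>C (d *\<^sub>C x) = (c * d) *\<^sub>C x"
    and scaleC_one: "1 *\<^sub>C x = x"
    and cinner_commute: "cinner x y = cnj (cinner y x)"
    and cinner_add_left: "cinner (x + y) z = cinner x z + cinner y z"
    and cinner_scaleC_left: "cinner (c *\<^sub>C x) y = c * cinner x y"
    and inner_Re_cinner: "x \<bullet> y = Re (cinner x y)"

class complex_hilbert = complex_inner + complete_space

instantiation complex :: complex_hilbert
begin

definition "scaleC_complex (c :: complex) x = c * x"
definition "cinner_complex (x :: complex) y = x * cnj y"

instance
  by standard
    (simp_all add: scaleC_complex_def cinner_complex_def scaleR_conv_of_real
      inner_complex_def algebra_simps)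

end

lemma cinner_self: "cinner x x = complex_of_real ((norm x)\<^sup>2)"
  by (metis cinner_commute inner_Re_cinner power2_norm_eq_inner complex_is_Real_iff
      Reals_cnj_iff of_real_Re)


section \<open>Bounded operators and von Neumann algebras\<close>

definition bounded_op :: "('a::complex_hilbert \<Rightarrow> 'a) \<Rightarrow> bool" where
  "bounded_op A \<longleftrightarrow> bounded_linear A \<and> (\<forall>c x. A (c *\<^sub>C x) = c *\<^sub>C A x)"

definition adj_op :: "('a::complex_hilbert \<Rightarrow> 'a) \<Rightarrow> 'a \<Rightarrow> 'a" where
  "adj_op A = (THE A'. \<forall>x y. cinner (A x) y = cinner x (A' y))"

text \<open>The coarsest topology on the bounded operators for which all maps
  \<open>A \<mapsto> \<langle>A x, y\<rangle>\<close> are continuous.\<close>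

definition weak_operator_topology :: "('a::complex_hilbert \<Rightarrow> 'a) topology" where
  "weak_operator_topology =
     topology_generated_by {{A. bounded_op A \<and> cinner (A x) y \<in> U} | x y U. open U}"

lemma topspace_weak_operator_topology:
  "topspace (weak_operator_topology :: ('a::complex_hilbert \<Rightarrow> 'a) topology) = Collect bounded_op"
proof -
  have "\<exists>(x::'a) y U. open U \<and> cinner (A x) y \<in> U" for A
    by (rule exI[of _ 0], rule exI[of _ 0], rule exI[of _ UNIV]) simp
  then show ?thesis
    unfolding weak_operator_topology_def topology_generated_by_topspace by blast
qed

definition von_neumann_algebra :: "('a::complex_hilbert \<Rightarrow> 'a) set \<Rightarrow> bool" where
  "von_neumann_algebra M \<longleftrightarrow>
     (\<forall>A\<in>M. bounded_op A) \<and>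
     id \<in> M \<and>
     (\<forall>A\<in>M. \<forall>B\<in>M. (\<lambda>x. A x + B x) \<in> M) \<and>
     (\<forall>c. \<forall>A\<in>M. (\<lambda>x. c *\<^sub>C A x) \<in> M) \<and>
     (\<forall>A\<in>M. \<forall>B\<in>M. A \<circ> B \<in> M) \<and>
     (\<forall>A\<in>M. adj_op A \<in> M) \<and>
     closedin weak_operator_topology M"


section \<open>Unbounded operators\<close>

text \<open>Unbounded operators are partial functions \<open>'a \<rightharpoonup> 'a\<close> with domain \<^term>\<open>dom T\<close> and
  range \<^term>\<open>ran T\<close>, so that equality of operators includes equality of domains.\<close>

definition unbounded_op :: "('a::complex_hilbert \<rightharpoonup> 'a) \<Rightarrow> bool" where
  "unbounded_op T \<longleftrightarrow>
     T 0 = Some 0 \<and>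
     (\<forall>x y u v. T x = Some u \<longrightarrow> T y = Some v \<longrightarrow> T (x + y) = Some (u + v)) \<and>
     (\<forall>c x u. T x = Some u \<longrightarrow> T (c *\<^sub>C x) = Some (c *\<^sub>C u))"

text \<open>An everywhere defined operator, regarded as an unbounded operator.\<close>

abbreviation total_op :: "('a \<Rightarrow> 'a) \<Rightarrow> ('a \<rightharpoonup> 'a)" where
  "total_op A \<equiv> (\<lambda>x. Some (A x))"

definition null_op :: "('a::complex_hilbert \<rightharpoonup> 'a) \<Rightarrow> 'a set" where
  "null_op T = {x \<in> dom T. T x = Some 0}"

text \<open>The orthogonal projection onto a closed subspace.\<close>

definition orth_proj :: "'a::complex_hilbert set \<Rightarrow> 'a \<Rightarrow> 'a" where
  "orth_proj S x = (THE p. p \<in> S \<and> (\<forall>y\<in>S. cinner (x - p) y = 0))"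

definition range_proj :: "('a::complex_hilbert \<rightharpoonup> 'a) \<Rightarrow> 'a \<Rightarrow> 'a" where
  "range_proj T = orth_proj (closure (ran T))"

definition null_proj :: "('a::complex_hilbert \<rightharpoonup> 'a) \<Rightarrow> 'a \<Rightarrow> 'a" where
  "null_proj T = orth_proj (closure (null_op T))"

text \<open>The quotient \<open>A/B\<close>, sending \<open>B x\<close> to \<open>A x\<close>; it is meaningful
  only if the null space of \<open>B\<close> is contained in that of \<open>A\<close>.\<close>

definition quotient_op :: "('a::complex_hilbert \<Rightarrow> 'a) \<Rightarrow> ('a \<Rightarrow> 'a) \<Rightarrow> ('a \<rightharpoonup> 'a)" where
  "quotient_op A B y =
     (if y \<in> range B then Some (THE z. \<exists>x. B x = y \<and> z = A x) else None)"

definition quotient_rep ::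
  "('a::complex_hilbert \<Rightarrow> 'a) set \<Rightarrow> ('a \<Rightarrow> 'a) \<Rightarrow> ('a \<Rightarrow> 'a) \<Rightarrow> ('a \<rightharpoonup> 'a) \<Rightarrow> bool" where
  "quotient_rep M A B T \<longleftrightarrow>
     A \<in> M \<and> B \<in> M \<and> null_op (total_op B) \<subseteq> null_op (total_op A) \<and> T = quotient_op A B"

definition M_aff :: "('a::complex_hilbert \<Rightarrow> 'a) set \<Rightarrow> ('a \<rightharpoonup> 'a) set" where
  "M_aff M = {T. \<exists>A B. quotient_rep M A B T}"

definition kaufman_inverse :: "('a::complex_hilbert \<rightharpoonup> 'a) \<Rightarrow> ('a \<rightharpoonup> 'a)" where
  "kaufman_inverse T y =
     (if y \<in> ran T then Some (THE z. \<exists>x. T x = Some y \<and> z = x - null_proj T x) else None)"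

definition one_to_one_op :: "('a::complex_hilbert \<rightharpoonup> 'a) \<Rightarrow> bool" where
  "one_to_one_op T \<longleftrightarrow> inj_on T (dom T)"

text \<open>The inverse of a one-to-one operator.\<close>

definition inverse_op :: "('a::complex_hilbert \<rightharpoonup> 'a) \<Rightarrow> ('a \<rightharpoonup> 'a)" where
  "inverse_op T y = (if y \<in> ran T then Some (THE x. T x = Some y) else None)"

lemma quotient_op_apply:
  assumes "bounded_op A" "bounded_op B" "null_op (total_op B) \<subseteq> null_op (total_op A)"
  shows "quotient_op A B (B x) = Some (A x)"
proof -
  have "A w = A x" if "B w = B x" for w
  proof -
    have "B (w - x) = 0"
      using assms(2) that by (simp add: bounded_op_def linear_diff bounded_linear.linear)
    then have "A (w - x) = 0" using assms(3) by (auto simp: null_op_def)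
    then show ?thesis
      using assms(1) by (simp add: bounded_op_def linear_diff bounded_linear.linear)
  qed
  then have "(THE z. \<exists>w. B w = B x \<and> z = A w) = A x" by blast
  then show ?thesis by (simp add: quotient_op_def)
qed

lemma unbounded_op_quotient_op:
  assumes "bounded_op A" "bounded_op B" "null_op (total_op B) \<subseteq> null_op (total_op A)"
  shows "unbounded_op (quotient_op A B)"
proof -
  note q = quotient_op_apply[OF assms]
  have lin: "linear A" "linear B" and
    sc: "\<And>c x. A (c *\<^sub>C x) = c *\<^sub>C A x" "\<And>c x. B (c *\<^sub>C x) = c *\<^sub>C B x"
    using assms by (auto simp: bounded_op_def bounded_linear.linear)
  have ex: "\<exists>w. y = B w \<and> u = A w" if "quotient_op A B y = Some u" for y u
  proof -
    have "y \<in> range B" using that by (auto simp: quotient_op_def split: if_splits)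
    then show ?thesis using that q by auto
  qed
  show ?thesis
    unfolding unbounded_op_def
  proof (intro conjI allI impI)
    show "quotient_op A B 0 = Some 0"
      using q[of 0] lin by (simp add: linear_0)
  next
    fix x y u v
    assume "quotient_op A B x = Some u" "quotient_op A B y = Some v"
    then obtain w z where "x = B w" "u = A w" "y = B z" "v = A z" using ex by metis
    then show "quotient_op A B (x + y) = Some (u + v)"
      using q[of "w + z"] lin by (simp add: linear_add)
  next
    fix c x u
    assume "quotient_op A B x = Some u"
    then obtain w where "x = B w" "u = A w" using ex by metis
    then show "quotient_op A B (c *\<^sub>C x) = Some (c *\<^sub>C u)"
      using q[of "c *\<^sub>C w"] sc by simp
  qed
qed

end

theory Submission
  imports Defs
begin

section \<open>Projections and adjoints in a Hilbert space\<close>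

text \<open>The graph of A/B is the set of pairs (B x, A x)
  (\<open>quotient_op_eq_Some_iff\<close>), and every claim is read off from it. The range of T is
  the range of A. The null space of T is the image of null(A) under B, that is, the range of B N(A).
  So R(T) and N(T) are range projections of elements of the algebra. Exchanging the coordinates of
  the graph gives B/A when null(A) = null(B); applying I - N(T) to the new second coordinate gives
  the Kaufman inverse, and this quotient is admissible because I - N(T) kills B x whenever A x = 0.

  The analytic content is that range and null projections of A stay in the algebra. Write A' for the
  adjoint. In \<open>vn_range_proj\<close>, R(A) is the strong limit of I - (I - r A A')^n, whose
  terms lie in the algebra, and an algebra closed in the weak operator topology contains such limits
  (\<open>vn_strong_limit\<close>). In \<open>vn_null_proj\<close>, N(A) = I - R(A'). Underneath lie
  \<open>projection_exists\<close>, obtained from the parallelogram law, and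
  \<open>riesz_representation\<close>, which yields the adjoint in
  \<open>adj_op_inner\<close>.\<close>

lemma dist_le_midpoint:
  fixes x s t :: "'a::real_inner"
  assumes "d \<le> (norm (x - (1/2) *\<^sub>R (s + t)))\<^sup>2"
    and "(norm (x - s))\<^sup>2 < d + e" and "(norm (x - t))\<^sup>2 < d + e"
  shows "(norm (s - t))\<^sup>2 < 4 * e"
proof -
  \<comment> \<open>This is the parallelogram law for x - s and x - t.\<close>
  have "(norm (s - t))\<^sup>2 = 2 * (norm (x - s))\<^sup>2 + 2 * (norm (x - t))\<^sup>2
      - 4 * (norm (x - (1/2) *\<^sub>R (s + t)))\<^sup>2"
    unfolding power2_norm_eq_inner by (simp add: algebra_simps inner_commute)
  then show ?thesis using assms by linarith
qed

text \<open>A minimizing sequence is Cauchy: midpoints of its terms stay in S, so their squared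
  distance to x is at least the infimum d, and \<open>dist_le_midpoint\<close> applies. Completeness
  supplies the limit, closedness keeps it in S.\<close>

lemma closest_point_exists_complete:
  fixes S :: "'a::{real_inner,complete_space} set"
  assumes "subspace S" "closed S"
  shows "\<exists>p\<in>S. \<forall>y\<in>S. dist x p \<le> dist x y"
proof -
  define d where "d = (INF s\<in>S. (norm (x - s))\<^sup>2)"
  have ne: "S \<noteq> {}" using subspace_0[OF assms(1)] by auto
  have bdd: "bdd_below ((\<lambda>s. (norm (x - s))\<^sup>2) ` S)" by (rule bdd_belowI[of _ 0]) auto
  have lower: "d \<le> (norm (x - s))\<^sup>2" if "s \<in> S" for s
    unfolding d_def using bdd that by (rule cINF_lower)
  have "\<exists>s\<in>S. (norm (x - s))\<^sup>2 < d + 1 / real (Suc n)" for n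
    using cInf_lessD[of "(\<lambda>s. (norm (x - s))\<^sup>2) ` S" "d + 1 / real (Suc n)"] ne
    by (auto simp: d_def)
  then obtain s where s: "\<And>n. s n \<in> S" "\<And>n. (norm (x - s n))\<^sup>2 < d + 1 / real (Suc n)"
    by metis
  have "Cauchy s"
  proof (rule metric_CauchyI)
    fix e :: real assume "0 < e"
    \<comment> \<open>The divisor 4 cancels the factor 4 of \<open>dist_le_midpoint\<close>.\<close>
    then have "0 < e\<^sup>2 / 4" by simp
    then obtain N where N: "1 / real (Suc N) < e\<^sup>2 / 4" using nat_approx_posE by blast
    have near: "(norm (x - s m))\<^sup>2 < d + e\<^sup>2 / 4" if "m \<ge> N" for m
    proof -
      have "1 / real (Suc m) \<le> 1 / real (Suc N)" using that by (simp add: frac_le)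
      then show ?thesis using s(2)[of m] N by linarith
    qed
    have "dist (s m) (s n) < e" if "m \<ge> N" "n \<ge> N" for m n
    proof -
      have "(1/2) *\<^sub>R (s m + s n) \<in> S"
        using assms(1) s(1) by (intro subspace_scale subspace_add)
      then have "(norm (s m - s n))\<^sup>2 < 4 * (e\<^sup>2 / 4)"
        using dist_le_midpoint[OF lower near near] that by blast
      then show ?thesis
        using \<open>0 < e\<close> by (auto simp: dist_norm intro: power2_less_imp_less)
    qed
    then show "\<exists>N. \<forall>m\<ge>N. \<forall>n\<ge>N. dist (s m) (s n) < e" by blast
  qed
  then obtain p where p: "s \<longlonglongrightarrow> p" using Cauchy_convergent convergent_def by blast
  have pS: "p \<in> S" using assms(2) s(1) p closed_sequentially by blast
  have "(\<lambda>n. (norm (x - s n))\<^sup>2) \<longlonglongrightarrow> (norm (x - p))\<^sup>2"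
    by (intro tendsto_intros p)
  moreover have "(\<lambda>n. d + 1 / real (Suc n)) \<longlonglongrightarrow> d + 0"
    using LIMSEQ_inverse_real_of_nat by (intro tendsto_intros) (simp add: inverse_eq_divide)
  ultimately have "(norm (x - p))\<^sup>2 \<le> d + 0"
    by (rule LIMSEQ_le) (use s(2) in \<open>auto intro: less_imp_le\<close>)
  then have "(norm (x - p))\<^sup>2 \<le> (norm (x - y))\<^sup>2" if "y \<in> S" for y
    using lower[OF that] by linarith
  then show ?thesis
    using pS by (auto simp: dist_norm intro: power2_le_imp_le)
qed

text \<open>A closest point satisfies a one-sided variational inequality; in a subspace it holds for
  both y and -y, hence is an equality.\<close>

lemma projection_exists:
  fixes S :: "'a::{real_inner,complete_space} set"
  assumes "subspace S" "closed S"
  obtains p where "p \<in> S" "\<And>y. y \<in> S \<Longrightarrow> (x - p) \<bullet> y = 0"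
proof -
  obtain p where p: "p \<in> S" "\<forall>y\<in>S. dist x p \<le> dist x y"
    using closest_point_exists_complete[OF assms] by blast
  have le: "(x - p) \<bullet> y \<le> 0" if "y \<in> S" for y
    using any_closest_point_dot[OF subspace_imp_convex[OF assms(1)] assms(2) p(1) _ p(2), of "p + y"]
      subspace_add[OF assms(1) p(1) that] by simp
  have "(x - p) \<bullet> y = 0" if "y \<in> S" for y
    using le[OF that] le[OF subspace_neg[OF assms(1) that]] by simp
  with p(1) show ?thesis using that by blast
qed

text \<open>The kernel of a nonzero f is a closed hyperplane. The residual z of a vector outside it
  is orthogonal to the kernel, and x minus a suitable multiple of z lies in the kernel.\<close>

lemma riesz_representation:
  fixes f :: "'a::{real_inner,complete_space} \<Rightarrow> real"
  assumes "bounded_linear f"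
  shows "\<exists>z. \<forall>x. f x = x \<bullet> z"
proof (cases "\<exists>u. f u \<noteq> 0")
  case True
  then obtain u where u: "f u \<noteq> 0" by blast
  interpret bounded_linear f by fact
  have "subspace {x. f x = 0}" by (simp add: subspace_def add scaleR)
  moreover have "closed {x. f x = 0}"
    by (intro closed_Collect_eq continuous_intros linear_continuous_on assms)
  ultimately obtain p where p: "f p = 0" "\<And>y. f y = 0 \<Longrightarrow> (u - p) \<bullet> y = 0"
    using projection_exists[of "{x. f x = 0}" u] by auto
  define z where "z = u - p"
  have fz: "f z \<noteq> 0" using u p(1) by (simp add: z_def diff)
  then have zz: "z \<bullet> z \<noteq> 0" using zero by auto
  have "f x = x \<bullet> ((f z / (z \<bullet> z)) *\<^sub>R z)" for x
  proof -
    have "z \<bullet> (x - (f x / f z) *\<^sub>R z) = 0"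
      unfolding z_def using p(2) fz by (simp add: diff scaleR z_def)
    then show ?thesis using fz zz by (simp add: field_simps inner_diff_right inner_commute)
  qed
  then show ?thesis by blast
qed (auto intro: exI[of _ 0])

section \<open>Complex scalars and the adjoint\<close>

lemma cinner_eq_Complex:
  fixes x y :: "'a::complex_inner"
  shows "cinner x y = Complex (x \<bullet> y) (x \<bullet> (\<i> *\<^sub>C y))"
proof -
  \<comment> \<open>Rotating the second argument by -\<i> turns the imaginary part into a real part,
    so the real inner product determines the complex one.\<close>
  have "cinner x (\<i> *\<^sub>C y) = - \<i> * cinner x y"
    by (subst (1 2) cinner_commute) (simp add: cinner_scaleC_left)
  then show ?thesis by (simp add: complex_eq_iff inner_Re_cinner)
qed

lemma inner_scaleC_left:
  fixes x y :: "'a::complex_inner"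
  shows "(c *\<^sub>C x) \<bullet> y = x \<bullet> (cnj c *\<^sub>C y)"
proof -
  have "cinner (c *\<^sub>C x) y = cinner x (cnj c *\<^sub>C y)"
    by (subst (2) cinner_commute) (simp add: cinner_scaleC_left flip: cinner_commute)
  then show ?thesis by (simp add: inner_Re_cinner)
qed

lemma norm_scaleC:
  fixes x :: "'a::complex_inner"
  shows "norm (c *\<^sub>C x) = cmod c * norm x"
proof (rule power2_eq_imp_eq)
  have "cnj c * c = complex_of_real ((cmod c)\<^sup>2)"
    by (simp only: complex_norm_square mult.commute)
  then have "(c *\<^sub>C x) \<bullet> (c *\<^sub>C x) = (cmod c)\<^sup>2 * (x \<bullet> x)"
    by (simp only: inner_scaleC_left scaleC_scaleC flip: scaleR_scaleC) simp
  then show "(norm (c *\<^sub>C x))\<^sup>2 = (cmod c * norm x)\<^sup>2"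
    by (simp add: power2_norm_eq_inner power_mult_distrib)
qed auto

lemma bounded_linear_scaleC: "bounded_linear ((*\<^sub>C) c :: 'a::complex_inner \<Rightarrow> 'a)"
proof (rule bounded_linear_intro)
  show "c *\<^sub>C (r *\<^sub>R x) = r *\<^sub>R (c *\<^sub>C x)" for r and x :: 'a
    by (simp add: scaleR_scaleC scaleC_scaleC mult.commute)
qed (auto simp: scaleC_add_right norm_scaleC intro: eq_refl)

lemma bounded_op_linear: "bounded_op A \<Longrightarrow> linear A"
  and bounded_op_scaleC: "bounded_op A \<Longrightarrow> A (c *\<^sub>C x) = c *\<^sub>C A x"
  by (auto simp: bounded_op_def bounded_linear.linear)

text \<open>Real Riesz representation gives a candidate A' for the real inner product. Since A
  commutes with multiplication by -\<i>, the candidate also satisfies the complex identity, and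
  uniqueness identifies it with the definite description \<open>adj_op A\<close>.\<close>

lemma adj_op_inner:
  assumes "bounded_op A"
  shows "A x \<bullet> y = x \<bullet> adj_op A y"
proof -
  have bl: "bounded_linear A" using assms by (simp add: bounded_op_def)
  have "bounded_linear (\<lambda>x. A x \<bullet> y)" for y
    using bounded_linear_compose[OF bounded_linear_inner_left bl] .
  then have "\<forall>y. \<exists>z. \<forall>x. A x \<bullet> y = x \<bullet> z"
    using riesz_representation by blast
  then have "\<exists>A'. \<forall>y x. A x \<bullet> y = x \<bullet> A' y" by (rule choice)
  then obtain A' where A': "A x \<bullet> y = x \<bullet> A' y" for x y by blast
  have swap: "x \<bullet> (\<i> *\<^sub>C z) = (- \<i> *\<^sub>C x) \<bullet> z" for x z :: 'a
    by (simp add: inner_scaleC_left)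
  have c: "cinner (A x) y = cinner x (A' y)" for x y
    using A'[of x y] A'[of "- \<i> *\<^sub>C x" y] bounded_op_scaleC[OF assms, of "- \<i>" x]
    by (simp add: cinner_eq_Complex swap)
  have "adj_op A = A'"
    unfolding adj_op_def
  proof (rule the_equality)
    fix D assume "\<forall>x y. cinner (A x) y = cinner x (D y)"
    then have "x \<bullet> D y = x \<bullet> A' y" for x y using c by (simp add: inner_Re_cinner)
    then show "D = A'" by (metis vector_eq_ldot ext)
  qed (use c in blast)
  then show ?thesis using A' by simp
qed

section \<open>Complex subspaces and orthogonal projections\<close>

definition csubspace :: "'a::complex_inner set \<Rightarrow> bool" where
  "csubspace S \<longleftrightarrow> subspace S \<and> (\<forall>c. \<forall>x\<in>S. c *\<^sub>C x \<in> S)"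

lemma csubspace_closure:
  assumes "csubspace S"
  shows "csubspace (closure S)"
proof -
  have sc: "c *\<^sub>C x \<in> S" if "x \<in> S" for c x
    using assms that by (auto simp: csubspace_def)
  have "(*\<^sub>C) c ` closure S \<subseteq> closure S" for c
    using sc closure_subset[of S]
    by (intro image_closure_subset linear_continuous_on bounded_linear_scaleC) auto
  then have scale: "c *\<^sub>C x \<in> closure S" if "x \<in> closure S" for c x
    using that by blast
  have "x + y \<in> closure S" if xy: "x \<in> closure S" "y \<in> closure S" for x y
  proof -
    obtain f g where "\<And>n. f n \<in> S" "f \<longlonglongrightarrow> x" "\<And>n. g n \<in> S" "g \<longlonglongrightarrow> y"
      using xy by (auto simp: closure_sequential)
    then have "\<And>n. f n + g n \<in> S" "(\<lambda>n. f n + g n) \<longlonglongrightarrow> x + y"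
      using assms by (auto simp: csubspace_def intro: subspace_add tendsto_add)
    then show ?thesis unfolding closure_sequential by (intro exI[of _ "\<lambda>n. f n + g n"]) simp
  qed
  moreover have "0 \<in> closure S"
    using assms closure_subset[of S] subspace_0 by (auto simp: csubspace_def)
  ultimately show ?thesis
    using scale by (auto simp: csubspace_def subspace_def scaleR_scaleC)
qed

lemma csubspace_image:
  assumes "bounded_op A" "csubspace S"
  shows "csubspace (A ` S)"
  using assms linear_subspace_image[OF bounded_op_linear, of A S]
  by (auto simp: csubspace_def simp flip: bounded_op_scaleC)

text \<open>Real orthogonality to S suffices: S contains \<i> y along with y, so the imaginary part
  of the complex inner product vanishes too. Uniqueness follows because the difference of two
  candidates lies in S and is orthogonal to itself.\<close>

lemma orth_proj_eqI:
  assumes "csubspace S" "p \<in> S" "\<And>y. y \<in> S \<Longrightarrow> (x - p) \<bullet> y = 0"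
  shows "orth_proj S x = p"
  unfolding orth_proj_def
proof (rule the_equality)
  show "p \<in> S \<and> (\<forall>y\<in>S. cinner (x - p) y = 0)"
    using assms by (auto simp: csubspace_def cinner_eq_Complex complex_eq_iff)
next
  fix q assume q: "q \<in> S \<and> (\<forall>y\<in>S. cinner (x - q) y = 0)"
  then have "p - q \<in> S" using assms by (auto simp: csubspace_def subspace_diff)
  then have "(x - q) \<bullet> (p - q) = 0" "(x - p) \<bullet> (p - q) = 0"
    using q assms(3) by (auto simp: inner_Re_cinner)
  then have "(p - q) \<bullet> (p - q) = 0" by (simp add: inner_diff_left)
  then show "q = p" by simp
qed

lemma orth_proj_props:
  assumes "csubspace S" "closed S"
  shows orth_proj_in: "orth_proj S x \<in> S"
    and orth_proj_orth: "y \<in> S \<Longrightarrow> (x - orth_proj S x) \<bullet> y = 0"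
proof -
  obtain p where "p \<in> S" "\<And>y. y \<in> S \<Longrightarrow> (x - p) \<bullet> y = 0"
    using projection_exists assms by (metis csubspace_def)
  with orth_proj_eqI[OF assms(1)] show "orth_proj S x \<in> S"
    and "y \<in> S \<Longrightarrow> (x - orth_proj S x) \<bullet> y = 0" by metis+
qed

lemma orth_proj_id: "csubspace S \<Longrightarrow> x \<in> S \<Longrightarrow> orth_proj S x = x"
  by (simp add: orth_proj_eqI)

lemma bounded_op_orth_proj:
  assumes S: "csubspace S" "closed S"
  shows "bounded_op (orth_proj S)"
proof -
  let ?P = "orth_proj S"
  note P = orth_proj_in[OF S] orth_proj_orth[OF S]
  have sub: "subspace S" and sc: "x \<in> S \<Longrightarrow> c *\<^sub>C x \<in> S" for c x
    using S by (auto simp: csubspace_def)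
  have add: "?P (x + y) = ?P x + ?P y" for x y
    using P(2)[of _ x] P(2)[of _ y]
    by (intro orth_proj_eqI S subspace_add sub P) (simp add: algebra_simps)
  have cs: "?P (c *\<^sub>C x) = c *\<^sub>C ?P x" for c x
  proof (intro orth_proj_eqI S sc P)
    fix y assume "y \<in> S"
    then have "(x - ?P x) \<bullet> (cnj c *\<^sub>C y) = 0" by (intro P sc)
    then show "(c *\<^sub>C x - c *\<^sub>C ?P x) \<bullet> y = 0"
      by (simp add: inner_diff_left inner_scaleC_left)
  qed
  have "norm (?P x) \<le> norm x * 1" for x
  proof -
    \<comment> \<open>The residual is orthogonal to the projection itself; Cauchy-Schwarz then gives
      the norm bound 1.\<close>
    have "(norm (?P x))\<^sup>2 = x \<bullet> ?P x"
      using P(2)[OF P(1), of x x] by (simp add: inner_diff_left power2_norm_eq_inner)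
    also have "\<dots> \<le> norm x * norm (?P x)" by (rule norm_cauchy_schwarz)
    finally show ?thesis by (cases "?P x = 0") (auto simp: power2_eq_square)
  qed
  then have "bounded_linear ?P"
    by (intro bounded_linear_intro[where K = 1] add) (auto simp: scaleR_scaleC cs)
  then show ?thesis using cs by (simp add: bounded_op_def)
qed

section \<open>Projections in a von Neumann algebra\<close>

text \<open>Pointwise norm convergence makes every matrix coefficient converge. This handles the
  subbasic open sets, and the property passes to finite intersections and arbitrary unions by
  induction on the generated topology.\<close>

lemma limitin_weak_operator_topology:
  assumes X: "\<And>n. bounded_op (X n)" and R: "bounded_op R" and lim: "\<And>x. (\<lambda>n. X n x) \<longlonglongrightarrow> R x"
  shows "limitin weak_operator_topology X R sequentially"
  unfolding limitin_def
proof (intro conjI allI impI)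
  show "R \<in> topspace weak_operator_topology" using R by (simp add: topspace_weak_operator_topology)
  fix U :: "('a \<Rightarrow> 'a) set" assume U: "openin weak_operator_topology U \<and> R \<in> U"
  then have "generate_topology_on {{A. bounded_op A \<and> cinner (A x) y \<in> U} | x y U. open U} U"
    by (simp add: weak_operator_topology_def openin_topology_generated_by_iff)
  then have "R \<in> U \<longrightarrow> (\<forall>\<^sub>F n in sequentially. X n \<in> U)"
  proof (induction rule: generate_topology_on.induct)
    case (Int a b)
    then show ?case by (auto intro: eventually_conj)
  next
    case (UN K)
    show ?case
    proof
      assume "R \<in> \<Union>K"
      then obtain k where "k \<in> K" "R \<in> k" by blast
      then show "\<forall>\<^sub>F n in sequentially. X n \<in> \<Union>K"
        using UN by (blast intro: eventually_mono)
    qed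
  next
    case (Basis s)
    then obtain x y V where s: "s = {A. bounded_op A \<and> cinner (A x) y \<in> V}" "open V" by blast
    have "(\<lambda>n. cinner (X n x) y) \<longlonglongrightarrow> cinner (R x) y"
      unfolding cinner_eq_Complex by (intro tendsto_intros lim)
    then show ?case using s X by (auto dest: topological_tendstoD)
  qed simp
  then show "\<forall>\<^sub>F n in sequentially. X n \<in> U" using U by blast
qed

lemma von_neumann_algebraD:
  assumes "von_neumann_algebra M"
  shows vn_bounded: "A \<in> M \<Longrightarrow> bounded_op A"
    and vn_id: "(\<lambda>x. x) \<in> M"
    and vn_scaleR: "A \<in> M \<Longrightarrow> (\<lambda>x. r *\<^sub>R A x) \<in> M"
    and vn_diff: "A \<in> M \<Longrightarrow> B \<in> M \<Longrightarrow> (\<lambda>x. A x - B x) \<in> M"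
    and vn_comp: "A \<in> M \<Longrightarrow> B \<in> M \<Longrightarrow> A \<circ> B \<in> M"
    and vn_adj: "A \<in> M \<Longrightarrow> adj_op A \<in> M"
    and vn_closed: "closedin weak_operator_topology M"
proof -
  note M = assms[unfolded von_neumann_algebra_def]
  show scale: "(\<lambda>x. r *\<^sub>R A x) \<in> M" if "A \<in> M" for r A
    using M that by (simp add: scaleR_scaleC)
  show "(\<lambda>x. A x - B x) \<in> M" if "A \<in> M" "B \<in> M"
  proof -
    have add: "(\<lambda>x. A x + C x) \<in> M" if "C \<in> M" for C using M \<open>A \<in> M\<close> that by simp
    show ?thesis using add[OF scale[OF that(2), of "-1"]] by simp
  qed
qed (use assms in \<open>auto simp: von_neumann_algebra_def id_def\<close>)

lemma vn_pow:
  assumes "von_neumann_algebra M" "A \<in> M"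
  shows "A ^^ n \<in> M"
proof (induction n)
  case 0
  show ?case using vn_id[OF assms(1)] by (simp add: id_def)
next
  case (Suc n)
  show ?case unfolding funpow.simps by (rule vn_comp[OF assms Suc])
qed

lemma vn_strong_limit:
  assumes "von_neumann_algebra M" "\<And>n. X n \<in> M" "bounded_op R"
    and "\<And>x. (\<lambda>n. X n x) \<longlonglongrightarrow> R x"
  shows "R \<in> M"
  using limitin_closedin[OF limitin_weak_operator_topology[of X R] vn_closed[OF assms(1)]]
    assms vn_bounded[OF assms(1)] by simp

section \<open>Range and null projections\<close>

lemma csubspace_range: "bounded_op A \<Longrightarrow> csubspace (range A)"
  by (rule csubspace_image) (auto simp: csubspace_def)

lemma csubspace_null: "bounded_op A \<Longrightarrow> csubspace {x. A x = 0}"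
  using linear_subspace_kernel[OF bounded_op_linear, of A]
    bounded_linear_scaleC[THEN bounded_linear.linear, THEN linear_0]
  by (auto simp: csubspace_def bounded_op_scaleC)

lemma closed_null: "bounded_op A \<Longrightarrow> closed {x. A x = 0}"
  by (intro closed_Collect_eq linear_continuous_on continuous_intros)
    (simp add: bounded_op_def)

text \<open>The hypothesis bounds the squared norm of K^n (y - K y) by a difference of consecutive
  squared norms along the orbit of y. These decrease and are nonnegative, so the differences tend to
  0. The powers of K are contractions, which carries the limit from the range of I - K to its
  closure.\<close>

lemma firmly_nonexpansive_pow_tendsto_0:
  fixes K :: "'a::real_inner \<Rightarrow> 'a"
  assumes "linear K" and K: "\<And>x. (norm (x - K x))\<^sup>2 \<le> (norm x)\<^sup>2 - (norm (K x))\<^sup>2"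
    and x: "x \<in> closure (range (\<lambda>y. y - K y))"
  shows "(\<lambda>n. (K ^^ n) x) \<longlonglongrightarrow> 0"
proof -
  have lin: "linear (K ^^ n)" for n
    by (induction n) (simp_all only: funpow.simps linear_compose[OF _ assms(1)] linear_id)
  have contr: "norm (K x) \<le> norm x" for x
  proof (rule power2_le_imp_le)
    show "(norm (K x))\<^sup>2 \<le> (norm x)\<^sup>2"
      using K[of x] zero_le_power2[of "norm (x - K x)"] by linarith
  qed simp
  have contr_pow: "norm ((K ^^ n) x) \<le> norm x" for n x
    by (induction n) (auto intro: order_trans[OF contr])
  have range_lim: "(\<lambda>n. (K ^^ n) (y - K y)) \<longlonglongrightarrow> 0" for y
  proof -
    define a where "a n = (norm ((K ^^ n) y))\<^sup>2" for n
    have "decseq a" using contr by (auto simp: decseq_Suc_iff a_def intro: power_mono)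
    then obtain L where L: "a \<longlonglongrightarrow> L"
      using decseq_convergent[of a 0] by (auto simp: a_def)
    have eq: "(K ^^ n) (y - K y) = (K ^^ n) y - K ((K ^^ n) y)" for n
      by (simp add: linear_diff[OF lin] funpow_swap1)
    have "(\<lambda>n. a n - a (Suc n)) \<longlonglongrightarrow> L - L"
      by (intro tendsto_diff L LIMSEQ_Suc)
    then have diff: "(\<lambda>n. a n - a (Suc n)) \<longlonglongrightarrow> 0" by simp
    have bound: "(norm ((K ^^ n) (y - K y)))\<^sup>2 \<le> a n - a (Suc n)" for n
      using K[of "(K ^^ n) y"] by (simp add: eq a_def)
    have "(\<lambda>n. (norm ((K ^^ n) (y - K y)))\<^sup>2) \<longlonglongrightarrow> 0"
      by (rule tendsto_sandwich[OF _ _ tendsto_const diff]) (auto simp: bound)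
    then have "(\<lambda>n. norm ((K ^^ n) (y - K y))) \<longlonglongrightarrow> 0"
      using tendsto_real_sqrt by fastforce
    then show ?thesis by (rule tendsto_norm_zero_cancel)
  qed
  show ?thesis
  proof (rule LIMSEQ_I)
    fix e :: real assume e: "0 < e"
    then obtain y where y: "norm (x - (y - K y)) < e / 2"
      using x unfolding closure_approachable
      by (metis (no_types, lifting) dist_norm half_gt_zero norm_minus_commute rangeE)
    obtain N where N: "\<And>n. n \<ge> N \<Longrightarrow> norm ((K ^^ n) (y - K y)) < e / 2"
      using LIMSEQ_D[OF range_lim, of "e / 2" y] e by auto
    have "norm ((K ^^ n) x) < e" if "n \<ge> N" for n
    proof -
      have "(K ^^ n) x = (K ^^ n) (x - (y - K y)) + (K ^^ n) (y - K y)"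
        by (simp add: linear_diff[OF lin])
      then have "norm ((K ^^ n) x) \<le> norm (x - (y - K y)) + norm ((K ^^ n) (y - K y))"
        by (metis contr_pow norm_triangle_mono order_refl)
      then show ?thesis using y N[OF that] by linarith
    qed
    then show "\<exists>N. \<forall>n\<ge>N. norm ((K ^^ n) x - 0) < e" by auto
  qed
qed

text \<open>With \<open>r > 0\<close> so small that \<open>r A A\<^sup>*\<close> is a contraction, the powers of \<open>1 - r A A\<^sup>*\<close> converge
  strongly to the projection onto the null space of \<open>A\<^sup>*\<close>, that is, to \<open>1 - R(A)\<close>.\<close>

lemma vn_range_proj:
  assumes M: "von_neumann_algebra M" and A: "A \<in> M"
  shows "orth_proj (closure (range A)) \<in> M"
proof -
  note bA = vn_bounded[OF M A]
  let ?A' = "adj_op A"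
  note A' = vn_adj[OF M A]
  note bA' = vn_bounded[OF M A']
  let ?S = "closure (range A)"
  let ?R = "orth_proj ?S"
  note S = csubspace_closure[OF csubspace_range[OF bA]] closed_closure[of "range A"]
  have adj: "A x \<bullet> y = x \<bullet> ?A' y" for x y by (rule adj_op_inner[OF bA])
  obtain k where k: "0 < k" "\<And>x. norm (A x) \<le> norm x * k"
    using bA bounded_linear.pos_bounded[of A] unfolding bounded_op_def by blast
  define r where "r = inverse (k\<^sup>2)"
  have r: "0 < r" "r * k\<^sup>2 = 1" using k(1) by (auto simp: r_def)
  define P where "P x = r *\<^sub>R A (?A' x)" for x
  define K where "K x = x - P x" for x
  have "(\<lambda>x. x - r *\<^sub>R (A \<circ> ?A') x) \<in> M"
    by (intro vn_diff[OF M] vn_id[OF M] vn_scaleR[OF M] vn_comp[OF M] A A')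
  then have KM: "K \<in> M" by (simp add: K_def[abs_def] P_def)
  note bK = vn_bounded[OF M KM]
  have P_in: "P x \<bullet> y = r * (?A' x \<bullet> ?A' y)" for x y by (simp add: P_def adj)
  \<comment> \<open>This inequality is exactly what makes K = I - P satisfy \<open>K_firm\<close>;
    the choice r k^2 = 1 absorbs one factor of r.\<close>
  have P_le: "(norm (P x))\<^sup>2 \<le> P x \<bullet> x" for x
  proof -
    have "(norm (P x))\<^sup>2 = r\<^sup>2 * (norm (A (?A' x)))\<^sup>2"
      using r by (simp add: P_def power_mult_distrib)
    also have "\<dots> \<le> r\<^sup>2 * (norm (?A' x) * k)\<^sup>2"
      using k by (intro mult_left_mono power_mono) auto
    also have "\<dots> = r * (r * k\<^sup>2) * (?A' x \<bullet> ?A' x)"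
      by (simp add: power2_norm_eq_inner power_mult_distrib power2_eq_square[of r])
    finally show ?thesis by (simp add: r P_in)
  qed
  have K_firm: "(norm (x - K x))\<^sup>2 \<le> (norm x)\<^sup>2 - (norm (K x))\<^sup>2" for x
  proof -
    have "(norm (K x))\<^sup>2 = (norm x)\<^sup>2 - 2 * (P x \<bullet> x) + (norm (P x))\<^sup>2"
      unfolding power2_norm_eq_inner K_def by (simp add: algebra_simps inner_commute)
    then show ?thesis using P_le[of x] by (simp add: K_def)
  qed
  have range_P: "range (\<lambda>y. y - K y) = range P" by (simp add: K_def)
  have bP: "csubspace (range P)"
  proof -
    have "(\<lambda>x. r *\<^sub>R (A \<circ> ?A') x) \<in> M"
      by (intro vn_scaleR[OF M] vn_comp[OF M] A A')
    then show ?thesis by (intro csubspace_range vn_bounded[OF M]) (simp add: P_def[abs_def])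
  qed
  have null_A': "?A' q = 0" if "\<And>y. q \<bullet> P y = 0" for q
  proof -
    have "r * (?A' q \<bullet> ?A' q) = 0" using that[of q] P_in[of q q] by (simp add: inner_commute)
    then show ?thesis using r by simp
  qed
  \<comment> \<open>The residual of x = A y is orthogonal to the range of P, so the adjoint kills
    it; it is then orthogonal to x as well as to p, and hence zero.\<close>
  have "range A \<subseteq> closure (range P)"
  proof
    fix x assume "x \<in> range A"
    then obtain y where x: "x = A y" by blast
    obtain p where p: "p \<in> closure (range P)" "\<And>z. z \<in> closure (range P) \<Longrightarrow> (x - p) \<bullet> z = 0"
      using projection_exists[of "closure (range P)" x] csubspace_closure[OF bP]
      by (auto simp: csubspace_def)
    have "?A' (x - p) = 0"
      by (rule null_A') (use p(2) closure_subset in blast)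
    then have "x \<bullet> (x - p) = 0" by (simp add: x adj)
    moreover have "p \<bullet> (x - p) = 0" using p by (simp add: inner_commute)
    ultimately have "(x - p) \<bullet> (x - p) = 0" by (simp add: inner_diff_left)
    then show "x \<in> closure (range P)" using p(1) by simp
  qed
  then have S_sub: "?S \<subseteq> closure (range P)" by (simp add: closure_minimal)
  have lim: "(\<lambda>n. x - (K ^^ n) x) \<longlonglongrightarrow> ?R x" for x
  proof -
    have "?R x \<in> closure (range (\<lambda>y. y - K y))"
      unfolding range_P using S_sub orth_proj_in[OF S] by blast
    then have "(\<lambda>n. (K ^^ n) (?R x)) \<longlonglongrightarrow> 0"
      by (rule firmly_nonexpansive_pow_tendsto_0[OF bounded_op_linear[OF bK] K_firm])
    \<comment> \<open>Split x along the range projection: K fixes the component annihilated by the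
      adjoint, and its powers send the other one to 0.\<close>
    moreover have "(K ^^ n) x = x - ?R x + (K ^^ n) (?R x)" for n
    proof -
      have "P z \<in> ?S" for z
        using csubspace_range[OF bA] closure_subset[of "range A"]
        by (auto simp: P_def csubspace_def intro!: subspace_scale subsetD[OF closure_subset])
      then have "?A' (x - ?R x) = 0" by (intro null_A' orth_proj_orth[OF S])
      then have "K (x - ?R x) = x - ?R x"
        by (simp add: K_def P_def linear_0[OF bounded_op_linear[OF bA]])
      then have "(K ^^ n) (x - ?R x) = x - ?R x" by (induction n) auto
      then show ?thesis
        using linear_add[OF bounded_op_linear[OF vn_bounded[OF M vn_pow[OF M KM]]],
            of n "x - ?R x" "?R x"] by simp
    qed
    ultimately have "(\<lambda>n. x - (x - ?R x + (K ^^ n) (?R x))) \<longlonglongrightarrow> x - (x - ?R x + 0)"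
      by (intro tendsto_intros)
    then show ?thesis using \<open>\<And>n. (K ^^ n) x = _\<close> by simp
  qed
  show ?thesis
    by (rule vn_strong_limit[OF M _ bounded_op_orth_proj[OF S] lim])
      (intro vn_diff[OF M] vn_id[OF M] vn_pow[OF M KM])
qed

text \<open>The null space of A is the orthogonal complement of the range of its adjoint, so its
  projection is the complement of a range projection.\<close>

lemma vn_null_proj:
  assumes M: "von_neumann_algebra M" and A: "A \<in> M"
  shows "orth_proj {x. A x = 0} \<in> M"
proof -
  note bA = vn_bounded[OF M A]
  note A' = vn_adj[OF M A]
  let ?S = "closure (range (adj_op A))"
  note S = csubspace_closure[OF csubspace_range[OF vn_bounded[OF M A']]]
    closed_closure[of "range (adj_op A)"]
  note adj = adj_op_inner[OF bA]
  have "orth_proj {x. A x = 0} x = x - orth_proj ?S x" for x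
  proof (rule orth_proj_eqI[OF csubspace_null[OF bA]])
    let ?q = "x - orth_proj ?S x"
    have "A ?q \<bullet> A ?q = 0"
      unfolding adj by (intro orth_proj_orth[OF S] subsetD[OF closure_subset]) auto
    then show "?q \<in> {x. A x = 0}" by simp
    fix y assume y: "y \<in> {x. A x = 0}"
    have "range (adj_op A) \<subseteq> {z. y \<bullet> z = 0}" using adj[of y] y by auto
    moreover have "closed {z. y \<bullet> z = 0}" by (intro closed_Collect_eq continuous_intros)
    ultimately have "?S \<subseteq> {z. y \<bullet> z = 0}" by (rule closure_minimal)
    then show "(x - ?q) \<bullet> y = 0" using orth_proj_in[OF S, of x] by (auto simp: inner_commute)
  qed
  then have "orth_proj {x. A x = 0} = (\<lambda>x. x - orth_proj ?S x)" ..
  then show ?thesis using vn_diff[OF M vn_id[OF M] vn_range_proj[OF M A']] by simp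
qed

section \<open>Quotients and their inverses\<close>

lemma null_op_total_op: "null_op (total_op A) = {x. A x = 0}"
  by (auto simp: null_op_def)

lemma ran_total_op: "ran (total_op A) = range A"
  by (auto simp: ran_def)

text \<open>This graph description replaces the definite description in \<open>quotient_op\<close>;
  ranges, null spaces and inverses of T are all computed from it.\<close>

lemma quotient_op_eq_Some_iff:
  assumes "bounded_op A" "bounded_op B" "null_op (total_op B) \<subseteq> null_op (total_op A)"
  shows "quotient_op A B w = Some u \<longleftrightarrow> (\<exists>x. w = B x \<and> u = A x)"
proof
  assume w: "quotient_op A B w = Some u"
  then obtain x where "w = B x" by (auto simp: quotient_op_def split: if_splits)
  then show "\<exists>x. w = B x \<and> u = A x" using w quotient_op_apply[OF assms, of x] by auto
qed (use quotient_op_apply[OF assms] in auto)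

theorem theorem4p9:
  fixes M :: "('a::complex_hilbert \<Rightarrow> 'a) set"
    and A B :: "'a \<Rightarrow> 'a"
    and T :: "'a \<rightharpoonup> 'a"
  assumes "von_neumann_algebra M"
    and "T \<in> M_aff M"
    and "quotient_rep M A B T"
  shows "(range_proj T \<in> M \<and> null_proj T \<in> M \<and>
            null_proj T = range_proj (total_op (B \<circ> null_proj (total_op A)))) \<and>
         (kaufman_inverse T \<in> M_aff M \<and>
            quotient_rep M ((\<lambda>x. x - null_proj T x) \<circ> B) A (kaufman_inverse T)) \<and>
         (one_to_one_op T \<longleftrightarrow> null_op (total_op A) = null_op (total_op B)) \<and>
         (one_to_one_op T \<longrightarrow>
            inverse_op T \<in> M_aff M \<and> quotient_rep M B A (inverse_op T))"
proof -
  note M = assms(1)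
  have A: "A \<in> M" and B: "B \<in> M" and nul: "null_op (total_op B) \<subseteq> null_op (total_op A)"
    and T: "T = quotient_op A B" using assms(3) by (auto simp: quotient_rep_def)
  note bA = vn_bounded[OF M A] and bB = vn_bounded[OF M B]
  note lin = bounded_op_linear[OF bA] bounded_op_linear[OF bB]
  have T_iff: "T w = Some u \<longleftrightarrow> (\<exists>x. w = B x \<and> u = A x)" for w u
    unfolding T by (rule quotient_op_eq_Some_iff[OF bA bB nul])
  have ranT: "ran T = range A" by (auto simp: ran_def T_iff)
  have nullT: "null_op T = B ` {x. A x = 0}" by (auto simp: null_op_def dom_def T_iff)
  let ?N = "null_proj (total_op A)"
  have N: "?N = orth_proj {x. A x = 0}"
    using closed_null[OF bA] by (simp add: null_proj_def null_op_total_op)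
  have NM: "?N \<in> M" unfolding N by (rule vn_null_proj[OF M A])
  \<comment> \<open>Writing null(A) as a range turns B applied to null(A) into the range of one
    element of the algebra.\<close>
  have rangeN: "range ?N = {x. A x = 0}"
  proof
    show "range ?N \<subseteq> {x. A x = 0}"
      unfolding N using orth_proj_in[OF csubspace_null[OF bA] closed_null[OF bA]] by blast
    show "{x. A x = 0} \<subseteq> range ?N"
      unfolding N using orth_proj_id[OF csubspace_null[OF bA]] by (metis rangeI subsetI)
  qed
  have nullT_eq: "null_proj T = range_proj (total_op (B \<circ> ?N))"
    by (simp only: null_proj_def[of T] range_proj_def ran_total_op nullT image_comp[symmetric] rangeN)
  have RM: "range_proj T \<in> M" unfolding range_proj_def ranT by (rule vn_range_proj[OF M A])
  have nTM: "null_proj T \<in> M"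
    unfolding nullT_eq range_proj_def ran_total_op by (intro vn_range_proj[OF M] vn_comp[OF M] B NM)
  let ?C = "(\<lambda>x. x - null_proj T x) \<circ> B"
  have CM: "?C \<in> M" by (intro vn_comp[OF M] vn_diff[OF M] vn_id[OF M] nTM B)
  have "csubspace (closure (null_op T))"
    unfolding nullT by (intro csubspace_closure csubspace_image bB csubspace_null bA)
  \<comment> \<open>This yields null(A) \<subseteq> null(\<open>?C\<close>), the condition for
    \<open>?C\<close>/A to be a quotient.\<close>
  then have nTB: "null_proj T (B x) = B x" if "A x = 0" for x
    unfolding null_proj_def using that closure_subset[of "null_op T"]
    by (intro orth_proj_id) (auto simp: nullT)
  have "kaufman_inverse T = quotient_op ?C A"
  proof
    fix y
    \<comment> \<open>Both sides are definite descriptions on the domain \<open>range A\<close>, so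
      equivalence of the describing predicates suffices.\<close>
    have "(\<exists>x. T x = Some y \<and> z = x - null_proj T x) \<longleftrightarrow> (\<exists>x. A x = y \<and> z = ?C x)" for z
      by (auto simp: T_iff)
    then show "kaufman_inverse T y = quotient_op ?C A y"
      unfolding kaufman_inverse_def quotient_op_def ranT by simp
  qed
  then have K: "quotient_rep M ?C A (kaufman_inverse T)"
    using CM A nTB by (auto simp: quotient_rep_def null_op_total_op)
  have inj_iff: "one_to_one_op T \<longleftrightarrow> null_op (total_op A) = null_op (total_op B)"
  proof
    assume inj: "one_to_one_op T"
    have "B x = 0" if "A x = 0" for x
    proof -
      have "T (B x) = Some 0" "T 0 = Some 0"
        using that linear_0[OF lin(1)] linear_0[OF lin(2)] by (auto simp: T_iff)
      then show ?thesis using inj by (auto simp: one_to_one_op_def inj_on_def dom_def)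
    qed
    then show "null_op (total_op A) = null_op (total_op B)"
      using nul by (auto simp: null_op_total_op)
  next
    assume eq: "null_op (total_op A) = null_op (total_op B)"
    have "w = w'" if "T w = Some u" "T w' = Some u" for w w' u
    proof -
      obtain x where x: "w = B x" "u = A x" using T_iff[of w u] \<open>T w = Some u\<close> by blast
      obtain x' where x': "w' = B x'" "u = A x'" using T_iff[of w' u] \<open>T w' = Some u\<close> by blast
      \<comment> \<open>Equal values of T put the difference of the parameters in null(A) = null(B),
        so the arguments B x and B x' coincide.\<close>
      have "A (x - x') = 0" using x x' by (simp add: linear_diff[OF lin(1)])
      then have "B (x - x') = 0" using eq by (auto simp: null_op_total_op)
      then show ?thesis using x x' by (simp add: linear_diff[OF lin(2)])
    qed
    then show "one_to_one_op T" by (auto simp: one_to_one_op_def inj_on_def dom_def)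
  qed
  have "inverse_op T = quotient_op B A"
  proof
    fix y
    have "T x = Some y \<longleftrightarrow> (\<exists>w. A w = y \<and> x = B w)" for x by (auto simp: T_iff)
    then show "inverse_op T y = quotient_op B A y"
      unfolding inverse_op_def quotient_op_def ranT by simp
  qed
  then have I: "quotient_rep M B A (inverse_op T)" if "one_to_one_op T"
    using that inj_iff A B by (auto simp: quotient_rep_def)
  show ?thesis
    using RM nTM nullT_eq K inj_iff I unfolding M_aff_def by blast
qed

end
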